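(* For all $n\ge1$: $f_{\text{2--1--2'}}(0,m,n)=2^{n-m-1}$ for $1\le m\le n-1$, and $f_{\text{2--1--2'}}(0,n,n)=1$.
   Context: The standard cycle form of $\pi\in\mathcal S_n$ writes each cycle starting with its smallest element, cycles listed in decreasing order of smallest elements; $\Psi(\pi)$ is the word obtained by deleting the parentheses. A cyclic occurrence of the partially ordered pattern 2--1--2' in $\pi$ is a triple of indices $i<j<k$ with $w_j<w_i$ and $w_j<w_k$, where $w=\Psi(\pi)$ (no condition relating $w_i$ and $w_k$); equivalently, an occurrence of 2--1--3 or of 3--1--2. $f_{\text{2--1--2'}}(k,m,n)$ is the number of $\pi\in\mathcal S_n$ with $m$ cycles and exactly $k$ cyclic occurrences of 2--1--2'. *)

theory Defs
  imports "HOL-Combinatorics.Orbits" "HOL-Combinatorics.Cycles"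
begin

text \<open>
  Elements of the symmetric group \<open>S_n\<close> are functions \<open>p\<close> with \<open>p permutes {1..n}\<close>. Since such a
  \<open>p\<close> is a bijection of a finite set, \<open>orbit p x\<close> contains \<open>x\<close> itself, so fixed points in
  \<open>{1..n}\<close> count as cycles of length one.
\<close>

definition cycle_sets :: "nat \<Rightarrow> (nat \<Rightarrow> nat) \<Rightarrow> nat set set" where
  "cycle_sets n p = orbit p ` {1..n}"

text \<open>
  \<open>support p a\<close> is the list \<open>[a, p a, p (p a), ...]\<close> that runs once through the cycle of \<open>a\<close>.
\<close>

definition standard_cycle_form :: "nat \<Rightarrow> (nat \<Rightarrow> nat) \<Rightarrow> nat list list" where
  "standard_cycle_form n p =
     map (support p) (rev (sorted_list_of_set (Min ` cycle_sets n p)))"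

definition Psi :: "nat \<Rightarrow> (nat \<Rightarrow> nat) \<Rightarrow> nat list" where
  "Psi n p = concat (standard_cycle_form n p)"

text \<open>Positions in a word are counted from 0.\<close>

definition occurrences_212' :: "nat list \<Rightarrow> (nat \<times> nat \<times> nat) set" where
  "occurrences_212' w =
     {(i, j, k). i < j \<and> j < k \<and> k < length w \<and> w ! j < w ! i \<and> w ! j < w ! k}"

definition f_212' :: "nat \<Rightarrow> nat \<Rightarrow> nat \<Rightarrow> nat" where
  "f_212' k m n =
     card {p. p permutes {1..n} \<and> card (cycle_sets n p) = m
              \<and> card (occurrences_212' (Psi n p)) = k}"

end

theory Submission
  imports Defs
begin

text \<open>
  A word avoids 2--1--2' iff it is unimodal. If \<open>\<Psi> p\<close> is unimodal, the cycles after the first one are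
  fixed points: a larger letter in such a cycle would form an occurrence with the minimum of that
  cycle and the (larger) first letter of the word. Hence a permutation with \<open>m\<close> cycles
  has an avoiding word iff it fixes \<open>1, \<dots>, m - 1\<close> and is a single cycle \<open>(m u)\<close> on \<open>{m..n}\<close> with \<open>u\<close>
  unimodal. The smallest letter of a unimodal word stands at one of the two ends, so a set with \<open>k > 0\<close>
  elements carries \<open>2 ^ (k - 1)\<close> unimodal words.
\<close>

section \<open>Unimodal words\<close>

text \<open>Since \<open>card\<close> is 0 on infinite sets, finiteness is what lets
  \<open>card = 0\<close> mean emptiness.\<close>

lemma finite_occurrences: "finite (occurrences_212' w)"
  by (rule finite_subset[of _ "{..length w} \<times> {..length w} \<times> {..length w}"])
    (auto simp: occurrences_212'_def)

text \<open>Splitting the word at the middle letter of a would-be occurrence replaces indices, so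
  adding a letter at either end requires no index shifts.\<close>

lemma no_occurrences_iff:
  "occurrences_212' w = {} \<longleftrightarrow>
     (\<forall>xs y zs. w = xs @ y # zs \<longrightarrow> (\<forall>a\<in>set xs. \<forall>c\<in>set zs. a \<le> y \<or> c \<le> y))"
  (is "?L \<longleftrightarrow> ?R")
proof
  assume L: ?L
  show ?R
  proof (intro allI impI ballI, rule ccontr)
    fix xs y zs a c
    assume w: "w = xs @ y # zs" and "a \<in> set xs" "c \<in> set zs" and lt: "\<not> (a \<le> y \<or> c \<le> y)"
    then obtain i k where "i < length xs" "xs ! i = a" "k < length zs" "zs ! k = c"
      by (metis in_set_conv_nth)
    with w lt have "(i, length xs, Suc (length xs + k)) \<in> occurrences_212' w"
      by (auto simp: occurrences_212'_def nth_append)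
    with L show False by simp
  qed
next
  assume R: ?R
  show ?L
  proof (rule ccontr)
    assume "\<not> ?L"
    then obtain i j k where ijk: "i < j" "j < k" "k < length w" "w ! j < w ! i" "w ! j < w ! k"
      by (auto simp: occurrences_212'_def)
    then have "w = take j w @ w ! j # drop (Suc j) w"
      by (simp add: id_take_nth_drop)
    moreover have "w ! i \<in> set (take j w)"
      using ijk by (auto simp: in_set_conv_nth intro!: exI[of _ i])
    moreover have "w ! k \<in> set (drop (Suc j) w)"
      using ijk by (auto simp: in_set_conv_nth intro!: exI[of _ "k - Suc j"])
    ultimately show False using R ijk by (meson not_less)
  qed
qed

lemma occurrence_empty_dest:
  assumes "occurrences_212' (xs @ y # zs) = {}" "a \<in> set xs" "c \<in> set zs"
  shows "a \<le> y \<or> c \<le> y"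
  using assms unfolding no_occurrences_iff by blast

text \<open>A first letter can only serve as the left 2 of an occurrence, and a least letter exceeds
  no middle letter.\<close>

lemma no_occurrences_Cons_least:
  assumes "\<forall>y\<in>set w. x \<le> y"
  shows "occurrences_212' (x # w) = {} \<longleftrightarrow> occurrences_212' w = {}"
proof
  assume "occurrences_212' (x # w) = {}"
  then show "occurrences_212' w = {}"
    unfolding no_occurrences_iff by (metis append_Cons list.set_intros(2))
next
  assume w: "occurrences_212' w = {}"
  show "occurrences_212' (x # w) = {}"
    unfolding no_occurrences_iff
  proof (intro allI impI ballI)
    fix xs y zs a c
    assume eq: "x # w = xs @ y # zs" and a: "a \<in> set xs" and c: "c \<in> set zs"
    then obtain xs' where xs': "xs = x # xs'" "w = xs' @ y # zs"
      by (cases xs) auto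
    show "a \<le> y \<or> c \<le> y"
    proof (cases "a = x")
      case True
      with assms xs' show ?thesis by simp
    next
      case False
      with a xs' have "a \<in> set xs'" by simp
      with occurrence_empty_dest w c xs' show ?thesis by blast
    qed
  qed
qed

text \<open>Mirror image of the previous lemma: a last letter can only serve as the 2'.\<close>

lemma no_occurrences_snoc_least:
  assumes "\<forall>y\<in>set w. x \<le> y"
  shows "occurrences_212' (w @ [x]) = {} \<longleftrightarrow> occurrences_212' w = {}"
proof
  assume L: "occurrences_212' (w @ [x]) = {}"
  show "occurrences_212' w = {}"
    unfolding no_occurrences_iff
  proof (intro allI impI ballI)
    fix xs y zs a c
    assume "w = xs @ y # zs" "a \<in> set xs" "c \<in> set zs"
    with L occurrence_empty_dest[of xs y "zs @ [x]" a c] show "a \<le> y \<or> c \<le> y" by simp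
  qed
next
  assume w: "occurrences_212' w = {}"
  show "occurrences_212' (w @ [x]) = {}"
    unfolding no_occurrences_iff
  proof (intro allI impI ballI)
    fix xs y zs a c
    assume eq: "w @ [x] = xs @ y # zs" and a: "a \<in> set xs" and c: "c \<in> set zs"
    then obtain zs' where zs': "zs = zs' @ [x]" "w = xs @ y # zs'"
      by (cases zs rule: rev_cases) auto
    show "a \<le> y \<or> c \<le> y"
    proof (cases "c = x")
      case True
      with assms zs' show ?thesis by simp
    next
      case False
      with c zs' have "c \<in> set zs'" by simp
      with occurrence_empty_dest w a zs' show ?thesis by blast
    qed
  qed
qed

text \<open>Each of the letters \<open>m - 1\<close>, ..., \<open>1\<close> is least when it is
  appended. In the application they are the fixed points that follow the long cycle.\<close>

lemma no_occurrences_append_decreasing: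
  assumes "\<forall>y\<in>set w. m \<le> y"
  shows "occurrences_212' (w @ rev [1..<m]) = {} \<longleftrightarrow> occurrences_212' w = {}"
proof -
  \<comment> \<open>Induction on the number \<open>k\<close> of appended letters; the lower bound of
    the interval moves, so the new letter comes last. The bound \<open>k < m\<close> prevents
    truncated subtraction.\<close>
  have "occurrences_212' (w @ rev [m - k..<m]) = {} \<longleftrightarrow> occurrences_212' w = {}" if "k < m" for k
    using that
  proof (induction k)
    case (Suc k)
    then have "[m - Suc k..<m] = (m - Suc k) # [m - k..<m]"
      by (metis Suc_diff_Suc Suc_lessD diff_less upt_conv_Cons zero_less_Suc less_trans)
    then have "w @ rev [m - Suc k..<m] = (w @ rev [m - k..<m]) @ [m - Suc k]" by simp
    moreover have "\<forall>y\<in>set (w @ rev [m - k..<m]). m - Suc k \<le> y"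
      using assms by force
    ultimately have "occurrences_212' (w @ rev [m - Suc k..<m]) = {} \<longleftrightarrow>
        occurrences_212' (w @ rev [m - k..<m]) = {}"
      by (metis no_occurrences_snoc_least)
    with Suc show ?case by simp
  qed simp
  from this[of "m - 1"] show ?thesis by (cases m) auto
qed

definition unimodal_words :: "nat set \<Rightarrow> nat list set" where
  "unimodal_words S = {w. distinct w \<and> set w = S \<and> occurrences_212' w = {}}"

text \<open>With letters on both sides, the least letter would be the middle of an occurrence, so it
  stands at an end; removing it or adding it there preserves avoidance.\<close>

lemma unimodal_words_insert_least:
  assumes "finite S" "\<forall>y\<in>S. a < y"
  shows "unimodal_words (insert a S) =
     (#) a ` unimodal_words S \<union> (\<lambda>w. w @ [a]) ` unimodal_words S"
    (is "_ = ?A \<union> ?B")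
proof
  show "unimodal_words (insert a S) \<subseteq> ?A \<union> ?B"
  proof
    fix w assume w: "w \<in> unimodal_words (insert a S)"
    then obtain xs zs where eq: "w = xs @ a # zs"
      unfolding unimodal_words_def by (metis (mono_tags, lifting) insertI1 mem_Collect_eq split_list)
    from w eq assms have sets: "set xs \<union> set zs = S" and dist: "distinct (xs @ zs)"
      by (auto simp: unimodal_words_def)
    have occ: "occurrences_212' (xs @ a # zs) = {}"
      using w eq by (simp add: unimodal_words_def)
    have "xs = [] \<or> zs = []"
    proof (rule ccontr)
      assume "\<not> (xs = [] \<or> zs = [])"
      then have "hd xs \<in> set xs" "hd zs \<in> set zs" by auto
      with occurrence_empty_dest[OF occ] sets assms(2) show False
        by (meson UnI1 UnI2 not_le)
    qed
    then show "w \<in> ?A \<union> ?B"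
    proof
      assume "xs = []"
      with occ sets assms(2) have "occurrences_212' zs = {}"
        using no_occurrences_Cons_least[of zs a] by (auto simp: less_imp_le)
      with \<open>xs = []\<close> sets dist eq show ?thesis by (auto simp: unimodal_words_def)
    next
      assume "zs = []"
      with occ sets assms(2) have "occurrences_212' xs = {}"
        using no_occurrences_snoc_least[of xs a] by (auto simp: less_imp_le)
      with \<open>zs = []\<close> sets dist eq show ?thesis by (auto simp: unimodal_words_def)
    qed
  qed
  show "?A \<union> ?B \<subseteq> unimodal_words (insert a S)"
  proof
    fix w assume "w \<in> ?A \<union> ?B"
    then obtain v where v: "v \<in> unimodal_words S" "w = a # v \<or> w = v @ [a]" by blast
    then have "\<forall>y\<in>set v. a \<le> y" "a \<notin> set v"
      using assms(2) by (auto simp: unimodal_words_def)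
    with v show "w \<in> unimodal_words (insert a S)"
      using no_occurrences_Cons_least[of v a] no_occurrences_snoc_least[of v a]
      by (auto simp: unimodal_words_def)
  qed
qed

lemma finite_unimodal_words: "finite S \<Longrightarrow> finite (unimodal_words S)"
  by (rule finite_subset[OF _ finite_subset_distinct])
    (auto simp: unimodal_words_def)

lemma card_unimodal_words:
  assumes "finite S"
  shows "card (unimodal_words S) = 2 ^ (card S - 1)"
  using assms
proof (induction S rule: finite_linorder_min_induct)
  case empty
  \<comment> \<open>The empty word alone is counted, in agreement with the truncated exponent
    \<open>0 - 1 = 0\<close>.\<close>
  have "unimodal_words {} = {[]}"
    by (auto simp: unimodal_words_def occurrences_212'_def)
  then show ?case by simp
next
  case (insert a S)
  note eq = unimodal_words_insert_least[OF insert.hyps]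
  show ?case
  \<comment> \<open>For empty \<open>S\<close> the two images coincide in \<open>[a]\<close>, so the
    count does not double.\<close>
  proof (cases "S = {}")
    case True
    have "unimodal_words {} = {[]}"
      by (auto simp: unimodal_words_def occurrences_212'_def)
    with True eq show ?thesis by simp
  next
    case False
    \<comment> \<open>A common word would start with \<open>a\<close> and also with a letter of the
      nonempty set \<open>S\<close>, all of which exceed \<open>a\<close>.\<close>
    have "(#) a ` unimodal_words S \<inter> (\<lambda>w. w @ [a]) ` unimodal_words S = {}"
    proof -
      have False if "a # v = w @ [a]" "v \<in> unimodal_words S" "w \<in> unimodal_words S" for v w
        using that False insert.hyps(2) by (cases w) (auto simp: unimodal_words_def)
      then show ?thesis by blast
    qed
    then have "card (unimodal_words (insert a S)) = 2 * card (unimodal_words S)"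
      using finite_unimodal_words[OF insert.hyps(1)]
      by (simp add: eq card_Un_disjoint card_image inj_on_def)
    moreover have "card S > 0" using False insert.hyps(1) by (simp add: card_gt_0_iff)
    moreover have "a \<notin> S" using insert.hyps(2) by blast
    ultimately show ?thesis
      using insert by (simp flip: power_Suc)
  qed
qed

section \<open>Cycles and their standard form\<close>

lemma set_support_eq_orbit:
  assumes "permutation p"
  shows "set (support p a) = orbit p a"
  unfolding support_set[OF assms] orbit_altdef_permutation[OF assms] by auto

lemma support_eq_Cons:
  assumes "permutation p"
  shows "support p a = a # tl (support p a)"
proof -
  have "[0..<least_power p a] = 0 # [1..<least_power p a]"
    using least_power_of_permutation(2)[OF assms, of a] by (simp add: upt_rec)
  then show ?thesis by simp
qed

lemma support_fixed_point:
  assumes "p x = x"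
  shows "support p x = [x]"
proof -
  have "least_power p x = 1"
    using assms unfolding least_power_def by (intro Least_equality) auto
  then show ?thesis by simp
qed

text \<open>Iterating the cycle \<open>i\<close> times rotates the list by \<open>i\<close> places;
  by distinctness the first return to \<open>a\<close> takes exactly the length of the list. Hence
  \<open>u\<close> can be read back from the permutation.\<close>

lemma support_cycle_of_list:
  assumes "distinct (a # u)"
  shows "support (cycle_of_list (a # u)) a = a # u"
proof -
  define p where "p = cycle_of_list (a # u)"
  let ?l = "length (a # u)"
  have pow: "(p ^^ i) a = (a # u) ! (i mod ?l)" for i
  proof -
    have "map (p ^^ i) (a # u) ! 0 = rotate i (a # u) ! 0"
      unfolding p_def cyclic_rotation[OF assms] ..
    also have "\<dots> = (a # u) ! (i mod ?l)"
      by (subst nth_rotate) auto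
    finally show ?thesis by simp
  qed
  have "least_power p a = ?l"
    unfolding least_power_def
  proof (rule Least_equality)
    show "(p ^^ ?l) a = a \<and> ?l > 0" unfolding pow by simp
    fix k assume k: "(p ^^ k) a = a \<and> k > 0"
    show "?l \<le> k"
    proof (rule ccontr)
      assume "\<not> ?l \<le> k"
      with k have "(a # u) ! k = (a # u) ! 0" "k < ?l" unfolding pow by simp_all
      then have "k = 0" using assms nth_eq_iff_index_eq by blast
      with k show False by simp
    qed
  qed
  then have "support p a = map (\<lambda>i. (a # u) ! (i mod ?l)) [0..<?l]"
    by (simp only: pow)
  also have "\<dots> = map ((!) (a # u)) [0..<?l]"
    by (rule map_cong) auto
  also have "\<dots> = a # u" by (rule map_nth)
  finally show ?thesis unfolding p_def .
qed

section \<open>Orbits, their minima, and the shape of permutations with avoiding words\<close>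

lemma orbit_eq_of_mem:
  assumes "permutation p" "y \<in> orbit p x"
  shows "orbit p y = orbit p x"
  using assms cyclic_on_orbit' orbit_cyclic_eq3 by metis

lemma finite_orbit_permutation: "permutation p \<Longrightarrow> finite (orbit p x)"
  by (rule finite_orbit) (rule permutation_self_in_orbit)

lemma Min_orbit:
  fixes p :: "nat \<Rightarrow> nat"
  assumes "permutation p"
  shows "Min (orbit p x) \<in> orbit p x" "Min (orbit p x) \<le> x"
    "orbit p (Min (orbit p x)) = orbit p x"
proof -
  show *: "Min (orbit p x) \<in> orbit p x"
    by (rule Min_in[OF finite_orbit_permutation[OF assms] orbit_nonempty])
  show "Min (orbit p x) \<le> x"
    using finite_orbit_permutation[OF assms] permutation_self_in_orbit[OF assms] by simp
  show "orbit p (Min (orbit p x)) = orbit p x"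
    by (rule orbit_eq_of_mem[OF assms *])
qed

text \<open>A cycle is recovered as the orbit of its minimum, so \<open>Min\<close> is injective on
  cycles.\<close>

lemma card_Min_cycle_sets:
  assumes "permutation p"
  shows "card (Min ` cycle_sets n p) = card (cycle_sets n p)"
proof (rule card_image, rule inj_onI)
  fix A B assume "A \<in> cycle_sets n p" "B \<in> cycle_sets n p" "Min A = Min B"
  then show "A = B"
    unfolding cycle_sets_def using Min_orbit(3)[OF assms] by (metis imageE)
qed

text \<open>Only the cycle sets are prescribed here; the order of letters within the cycle of
  \<open>m\<close> stays free. For \<open>m = n \<ge> 1\<close> only the identity qualifies.\<close>

definition one_cycle_above :: "nat \<Rightarrow> nat \<Rightarrow> (nat \<Rightarrow> nat) \<Rightarrow> bool" where
  "one_cycle_above m n p \<longleftrightarrow>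
     p permutes {1..n} \<and> (\<forall>x\<in>{1..<m}. p x = x) \<and> orbit p m = {m..n}"

lemma permutes_interval_permutation: "p permutes {1..n::nat} \<Longrightarrow> permutation p"
  using permutation_permutes by blast

text \<open>The largest cycle minimum \<open>c\<close> opens the word. Any other minimum
  \<open>d\<close> is smaller and comes later, so if it were moved, \<open>c\<close>,
  \<open>d\<close>, \<open>p d\<close> would form an occurrence. Thus all cycles but that of
  \<open>c\<close> are fixed points.\<close>

lemma one_cycle_above_if_no_occurrences:
  assumes p: "p permutes {1..n}" and "n \<ge> 1" and occ: "occurrences_212' (Psi n p) = {}"
  shows "one_cycle_above (card (cycle_sets n p)) n p"
proof -
  note perm = permutes_interval_permutation[OF p]
  define M where "M = Min ` cycle_sets n p"
  define c where "c = Max M"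
  have fin: "finite M" by (simp add: M_def cycle_sets_def)
  have "M \<noteq> {}" using \<open>n \<ge> 1\<close> by (simp add: M_def cycle_sets_def)
  then have "c \<in> M" using fin by (simp add: c_def)
  have le_c: "d \<le> c" if "d \<in> M" for d using fin that by (simp add: c_def)
  have Min_M: "Min (orbit p x) \<in> M" if "x \<in> {1..n}" for x
    using that by (auto simp: M_def cycle_sets_def)
  have M_Min: "d \<in> {1..n} \<and> (\<forall>y\<in>orbit p d. d \<le> y)" if "d \<in> M" for d
  proof -
    from that obtain x where x: "x \<in> {1..n}" "d = Min (orbit p x)"
      by (auto simp: M_def cycle_sets_def)
    then show ?thesis
      using Min_orbit[OF perm, of x] permutes_orbit_subset[OF p x(1)]
        finite_orbit_permutation[OF perm, of x] by auto
  qed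
  have fixed: "p d = d" if d: "d \<in> M" "d \<noteq> c" for d
  proof (rule ccontr)
    assume "p d \<noteq> d"
    define L where "L = rev (sorted_list_of_set M)"
    have L: "set L = M" "sorted (rev L)" "distinct L" using fin by (simp_all add: L_def)
    obtain us vs where L_eq: "L = us @ d # vs" using d L(1) by (metis split_list)
    \<comment> \<open>The list of minima is decreasing, so its maximum \<open>c\<close> precedes
      \<open>d\<close>.\<close>
    have "c \<in> set us"
    proof (rule ccontr)
      assume "c \<notin> set us"
      with d L_eq L(1) \<open>c \<in> M\<close> have "c \<in> set vs" by auto
      then have "c \<le> d" using L(2) by (auto simp: L_eq sorted_append)
      with le_c[OF d(1)] d(2) show False by simp
    qed
    let ?xs = "concat (map (support p) us)" and ?zs = "concat (map (support p) vs)"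
    \<comment> \<open>The word is split at \<open>d\<close>: the part before it contains
      \<open>c\<close>, the part after it contains \<open>p d\<close>.\<close>
    have Psi_eq: "Psi n p = ?xs @ d # (tl (support p d) @ ?zs)"
      using support_eq_Cons[OF perm, of d]
      unfolding Psi_def standard_cycle_form_def M_def[symmetric] L_def[symmetric] L_eq
      by (metis (no_types, lifting) append_Cons append_assoc concat.simps(2) concat_append
        list.simps(9) map_append)
    have "c \<in> set (support p c)" using support_eq_Cons[OF perm, of c] by (metis list.set_intros(1))
    moreover obtain us1 us2 where "us = us1 @ c # us2" using \<open>c \<in> set us\<close> by (metis split_list)
    ultimately have "c \<in> set ?xs" by simp
    have "p d \<in> set (support p d)" unfolding set_support_eq_orbit[OF perm] by (rule orbit.base)
    with \<open>p d \<noteq> d\<close> have "p d \<in> set (tl (support p d))"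
      using support_eq_Cons[OF perm, of d] by (metis set_ConsD)
    then have "p d \<in> set (tl (support p d) @ ?zs)" by simp
    with occurrence_empty_dest[OF occ[unfolded Psi_eq] \<open>c \<in> set ?xs\<close>]
    have "c \<le> d \<or> p d \<le> d" by blast
    with M_Min[OF d(1)] \<open>p d \<noteq> d\<close> le_c[OF d(1)] d(2) show False
      by (metis le_antisym orbit.base)
  qed
  have orbit_d: "orbit p d = {d}" if "d \<in> M" "d \<noteq> c" for d
    using fixed[OF that] by (simp add: orbit_eq_singleton_iff)
  \<comment> \<open>The cycle of such an \<open>x\<close> has a minimum other than \<open>c\<close>,
    hence is a singleton, and \<open>x\<close> is that minimum.\<close>
  have other: "x \<in> M \<and> x < c" if x: "x \<in> {1..n}" "x \<notin> orbit p c" for x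
  proof -
    let ?d = "Min (orbit p x)"
    have self: "x \<in> orbit p ?d"
      using Min_orbit(3)[OF perm, of x] permutation_self_in_orbit[OF perm] by simp
    then have "?d \<noteq> c" using x(2) by metis
    with orbit_d Min_M[OF x(1)] self have "x = ?d" by blast
    with \<open>?d \<noteq> c\<close> Min_M[OF x(1)] le_c show ?thesis by (metis le_neq_implies_less)
  qed
  have c: "c \<in> {1..n}" and c_least: "\<forall>y\<in>orbit p c. c \<le> y"
    using M_Min[OF \<open>c \<in> M\<close>] by auto
  have below: "x \<in> M" if "x \<in> {1..<c}" for x
    using that other[of x] c c_least by (metis atLeastAtMost_iff atLeastLessThan_iff le_trans less_imp_le not_le)
  \<comment> \<open>Points below \<open>c\<close> lie outside its orbit and so are minima
    themselves; counting minima then identifies \<open>c\<close> with the number of cycles.\<close>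
  have "M = {1..c}"
    using below M_Min le_c \<open>c \<in> M\<close> by (auto simp: le_less)
  then have "card (cycle_sets n p) = c"
    using card_Min_cycle_sets[OF perm, of n] by (simp add: M_def)
  moreover have "orbit p c = {c..n}"
  proof
    show "orbit p c \<subseteq> {c..n}" using c_least permutes_orbit_subset[OF p c] by auto
    show "{c..n} \<subseteq> orbit p c"
    proof
      fix x assume "x \<in> {c..n}"
      then show "x \<in> orbit p c" using other[of x] c by fastforce
    qed
  qed
  ultimately show ?thesis
    using p fixed below by (simp add: one_cycle_above_def)
qed

lemma one_cycle_above_properties:
  assumes "one_cycle_above m n p" and m: "m \<in> {1..n}"
  shows "card (cycle_sets n p) = m" "Psi n p = support p m @ rev [1..<m]"
proof -
  from assms have p: "p permutes {1..n}" and fixed: "\<And>x. x \<in> {1..<m} \<Longrightarrow> p x = x"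
    and orb: "orbit p m = {m..n}" by (auto simp: one_cycle_above_def)
  note perm = permutes_interval_permutation[OF p]
  have "{1..n} = {1..<m} \<union> {m..n}" using m by auto
  moreover have "orbit p ` {1..<m} = (\<lambda>x. {x}) ` {1..<m}"
    using fixed by (intro image_cong) (simp_all add: orbit_eq_singleton_iff)
  moreover have "orbit p ` {m..n} = {{m..n}}"
    using orbit_eq_of_mem[OF perm, of _ m] m by (auto simp: orb)
  ultimately have cs: "cycle_sets n p = (\<lambda>x. {x}) ` {1..<m} \<union> {{m..n}}"
    by (simp only: cycle_sets_def image_Un)
  have "Min {m..n} = m" using m by (intro Min_eqI) auto
  \<comment> \<open>The half-open form matches \<open>sorted_list_of_set_range\<close>, which turns
    the set into \<open>[1..<Suc m]\<close>.\<close>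
  then have M: "Min ` cycle_sets n p = {1..<Suc m}"
    using m by (auto simp: cs image_Un image_image)
  then show "card (cycle_sets n p) = m"
    using card_Min_cycle_sets[OF perm, of n] by simp
  have "concat (map (support p) xs) = xs" if "set xs \<subseteq> {1..<m}" for xs
    using that
  proof (induction xs)
    case (Cons x xs)
    then have "p x = x" using fixed by simp
    then have "support p x = [x]" by (rule support_fixed_point)
    with Cons show ?case by simp
  qed simp
  from this[of "rev [1..<m]"]
  have "concat (map (support p) (rev [1..<m])) = rev [1..<m]" by simp
  moreover have "rev [1..<Suc m] = m # rev [1..<m]" using m by simp
  ultimately show "Psi n p = support p m @ rev [1..<m]"
    unfolding Psi_def standard_cycle_form_def M sorted_list_of_set_range by simp
qed

section \<open>From unimodal words to permutations, and the count\<close>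

lemma one_cycle_above_cycle_of_list:
  assumes m: "m \<in> {1..n}" and u: "distinct u" "set u = {m<..n}"
  shows "one_cycle_above m n (cycle_of_list (m # u))"
proof -
  let ?p = "cycle_of_list (m # u)"
  have set_eq: "set (m # u) = {m..n}" using m u by auto
  have "?p permutes {m..n}" using cycle_permutes[of "m # u"] by (simp only: set_eq)
  then have "?p permutes {1..n}" by (rule permutes_subset) (use m in auto)
  moreover have "\<forall>x\<in>{1..<m}. ?p x = x"
    using set_eq by (auto intro!: id_outside_supp simp del: set_simps)
  moreover have "orbit ?p m = {m..n}"
  proof -
    have "support ?p m = m # u" using u by (intro support_cycle_of_list) simp
    then show ?thesis
      using set_support_eq_orbit[OF permutation_of_cycle, of "m # u" m] set_eq by argo
  qed
  ultimately show ?thesis by (simp add: one_cycle_above_def)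
qed

text \<open>The leading \<open>m\<close> is least in \<open>m # u\<close>, and the fixed points
  after it descend below \<open>m\<close>; neither takes part in an occurrence, so only
  \<open>u\<close> matters.\<close>

lemma no_occurrences_Psi_iff:
  assumes "one_cycle_above m n p" "m \<in> {1..n}" "support p m = m # u"
  shows "occurrences_212' (Psi n p) = {} \<longleftrightarrow> u \<in> unimodal_words {m<..n}"
proof -
  have perm: "permutation p"
    using assms(1) permutes_interval_permutation by (auto simp: one_cycle_above_def)
  have "set (m # u) = {m..n}"
    using set_support_eq_orbit[OF perm, of m] assms by (simp add: one_cycle_above_def)
  moreover have dist: "distinct (m # u)" using cycle_of_permutation[OF perm, of m] assms(3) by simp
  ultimately have "set u = {m..n} - {m}"
    by (metis Diff_insert_absorb distinct.simps(2) list.simps(15))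
  also have "\<dots> = {m<..n}" by auto
  finally have u: "set u = {m<..n}" .
  have "Psi n p = (m # u) @ rev [1..<m]"
    using one_cycle_above_properties(2)[OF assms(1,2)] assms(3) by argo
  moreover have "\<forall>y\<in>set (m # u). m \<le> y" by (simp add: u)
  ultimately have "occurrences_212' (Psi n p) = {} \<longleftrightarrow> occurrences_212' (m # u) = {}"
    using no_occurrences_append_decreasing by metis
  also have "\<dots> \<longleftrightarrow> occurrences_212' u = {}"
    by (rule no_occurrences_Cons_least) (simp add: u)
  finally show ?thesis using u dist by (simp add: unimodal_words_def)
qed

text \<open>Closing \<open>m # u\<close> into a cycle is a bijection from unimodal words on
  \<open>{m<..n}\<close>. The case \<open>m = n\<close> is included: the interval is empty and the
  truncated exponent gives \<open>2 ^ 0 = 1\<close>.\<close>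

lemma f_212'_zero:
  assumes m: "m \<in> {1..n}"
  shows "f_212' 0 m n = 2 ^ (n - m - 1)"
proof -
  let ?P = "{p. p permutes {1..n} \<and> card (cycle_sets n p) = m
              \<and> card (occurrences_212' (Psi n p)) = 0}"
  have P_eq: "?P = {p. one_cycle_above m n p \<and> occurrences_212' (Psi n p) = {}}"
  proof (rule Collect_cong, rule iffI)
    fix p
    assume "p permutes {1..n} \<and> card (cycle_sets n p) = m
              \<and> card (occurrences_212' (Psi n p)) = 0"
    then show "one_cycle_above m n p \<and> occurrences_212' (Psi n p) = {}"
      using one_cycle_above_if_no_occurrences[of p n] m by (simp add: finite_occurrences)
  next
    fix p assume "one_cycle_above m n p \<and> occurrences_212' (Psi n p) = {}"
    then show "p permutes {1..n} \<and> card (cycle_sets n p) = m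
              \<and> card (occurrences_212' (Psi n p)) = 0"
      using one_cycle_above_properties(1)[of m n p] m by (simp add: one_cycle_above_def)
  qed
  have "bij_betw (\<lambda>u. cycle_of_list (m # u)) (unimodal_words {m<..n}) ?P"
    unfolding bij_betw_def
  proof
    show "inj_on (\<lambda>u. cycle_of_list (m # u)) (unimodal_words {m<..n})"
    proof (rule inj_onI)
      fix u v assume "u \<in> unimodal_words {m<..n}" "v \<in> unimodal_words {m<..n}"
        and eq: "cycle_of_list (m # u) = cycle_of_list (m # v)"
      then have "distinct (m # u)" "distinct (m # v)" by (auto simp: unimodal_words_def)
      from this[THEN support_cycle_of_list] have "m # u = m # v"
        unfolding eq by (rule trans[OF sym])
      then show "u = v" by simp
    qed
    show "(\<lambda>u. cycle_of_list (m # u)) ` unimodal_words {m<..n} = ?P"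
      unfolding P_eq
    proof (intro equalityI subsetI)
      fix p assume "p \<in> (\<lambda>u. cycle_of_list (m # u)) ` unimodal_words {m<..n}"
      then obtain u where u: "u \<in> unimodal_words {m<..n}" and p: "p = cycle_of_list (m # u)"
        by blast
      have one: "one_cycle_above m n p"
        using u unfolding p by (intro one_cycle_above_cycle_of_list m) (simp_all add: unimodal_words_def)
      have "support p m = m # u"
        using u unfolding p by (intro support_cycle_of_list) (simp add: unimodal_words_def)
      from no_occurrences_Psi_iff[OF one m this] one u
      show "p \<in> {p. one_cycle_above m n p \<and> occurrences_212' (Psi n p) = {}}" by simp
    next
      fix p assume "p \<in> {p. one_cycle_above m n p \<and> occurrences_212' (Psi n p) = {}}"
      then have p: "one_cycle_above m n p" "occurrences_212' (Psi n p) = {}" by auto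
      then have perm: "permutation p"
        using permutes_interval_permutation by (auto simp: one_cycle_above_def)
      obtain u where u: "support p m = m # u" using support_eq_Cons[OF perm] by blast
      have "u \<in> unimodal_words {m<..n}" using no_occurrences_Psi_iff[OF p(1) m u] p(2) by simp
      \<comment> \<open>On the cycle of \<open>m\<close> both maps agree by
        \<open>cycle_restrict\<close>; elsewhere both fix the point, being either below
        \<open>m\<close> or outside \<open>{1..n}\<close>.\<close>
      moreover have "p = cycle_of_list (m # u)"
      proof
        fix x
        show "p x = cycle_of_list (m # u) x"
        proof (cases "x \<in> set (support p m)")
          case True
          then show ?thesis using cycle_restrict[OF perm, of x m] u by argo
        next
          case False
          then have "x \<notin> {m..n}"
            using p(1) by (simp only: set_support_eq_orbit[OF perm] one_cycle_above_def) simp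
          then have "x \<in> {1..<m} \<or> x \<notin> {1..n}" by auto
          then have "p x = x" using p(1) by (auto simp: one_cycle_above_def permutes_def)
          moreover have "cycle_of_list (m # u) x = x"
            using False id_outside_supp u by metis
          ultimately show ?thesis by simp
        qed
      qed
      ultimately show "p \<in> (\<lambda>u. cycle_of_list (m # u)) ` unimodal_words {m<..n}" by blast
    qed
  qed
  then have "f_212' 0 m n = card (unimodal_words {m<..n})"
    unfolding f_212'_def by (simp add: bij_betw_same_card)
  then show ?thesis by (simp add: card_unimodal_words)
qed

theorem mainTheorem16:
  fixes n :: nat
  assumes "n \<ge> 1"
  shows "(\<forall>m. 1 \<le> m \<and> m \<le> n - 1 \<longrightarrow> f_212' 0 m n = 2 ^ (n - m - 1)) \<and> f_212' 0 n n = 1"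
  using assms f_212'_zero[of _ n] by auto

end
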